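(* Let $r\ge 0$ and let $\pi_1,\dots,\pi_r,\pi'_1,\dots,\pi'_r$ be permutations such that, for every $i\in\{1,\dots,r\}$, the sets $\{312,\pi_i\}$ and $\{312,\pi'_i\}$ are $\mathrm{inv}$-Wilf equivalent. Set $\pi=\iota_r[\pi_{1*},\dots,\pi_{r*}]$ and $\pi'=\iota_r[\pi'_{1*},\dots,\pi'_{r*}]$. Then $\{312,\pi\}$ and $\{312,\pi'\}$ are $\mathrm{inv}$-Wilf equivalent, i.e. $F^{\mathrm{inv}}_n(\{312,\pi\};q)=F^{\mathrm{inv}}_n(\{312,\pi'\};q)$ for all $n\ge 0$.
   Context: $\mathfrak{S}_n$ is the set of permutations of $\{1,\dots,n\}$ in one-line notation, $\mathfrak{S}=\bigcup_{n\ge 0}\mathfrak{S}_n$, and $\mathfrak{S}_0=\{\epsilon\}$ with $\epsilon$ the empty permutation. A permutation $\sigma$ contains $\pi$ if some subsequence of $\sigma$ has the same relative order as $\pi$ (so every permutation contains $\epsilon$); otherwise $\sigma$ avoids $\pi$. For $\Pi\subseteq\mathfrak{S}$, $\mathfrak{S}_n(\Pi)$ is the set of $\sigma\in\mathfrak{S}_n$ avoiding every pattern in $\Pi$. The inversion number of $\sigma\in\mathfrak{S}_n$ is $\mathrm{inv}(\sigma)=\#\{(i,j): 1\le i<j\le n,\ \sigma(i)>\sigma(j)\}$, and $F^{\mathrm{inv}}_n(\Pi;q)=\sum_{\sigma\in\mathfrak{S}_n(\Pi)}q^{\mathrm{inv}(\sigma)}$. Two sets $\Pi,\Pi'$ are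 $\mathrm{inv}$-Wilf equivalent if $F^{\mathrm{inv}}_n(\Pi;q)=F^{\mathrm{inv}}_n(\Pi';q)$ for all $n\ge 0$. For $\tau\in\mathfrak{S}_k$ and $\sigma_1,\dots,\sigma_k\in\mathfrak{S}$, the inflation $\tau[\sigma_1,\dots,\sigma_k]$ is the permutation that is a concatenation of $k$ consecutive blocks of positions, the $i$-th block (of length $|\sigma_i|$) having the relative order of $\sigma_i$ and occupying an interval of values, with the blocks' value intervals arranged relative to one another in the order of $\tau$ (all values in block $i$ are less than all values in block $j$ iff $\tau(i)<\tau(j)$); e.g. $213[123,1,21]=234165$. $\iota_r=12\cdots r$ is the identity of $\mathfrak{S}_r$ (and $\iota_0[\,]=\epsilon$), so $\iota_r[\sigma_1,\dots,\sigma_r]$ is the direct sum of the $\sigma_i$. For a permutation $\pi\in\mathfrak{S}_m$, $\pi_*:=21[\pi,1]\in\mathfrak{S}_{m+1}$, i.e. $\pi_*=(\pi(1)+1)\cdots(\pi(m)+1)\,1$; and $\pi_{i*}$ means $(\pi_i)_*$. *)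

theory Defs
  imports
    "HOL-Combinatorics.Multiset_Permutations"
    "HOL-Computational_Algebra.Polynomial"
    "HOL-Library.Sublist"
begin

text \<open>
  A permutation of \<open>{1..n}\<close> is represented by its one-line notation, a list of natural numbers.
  List positions count from 0, values count from 1.
\<close>

definition perms_of :: "nat \<Rightarrow> nat list set" where
  "perms_of n = permutations_of_set {1..n}"

definition perms :: "nat list set" where
  "perms = (\<Union>n. perms_of n)"

definition same_order :: "nat list \<Rightarrow> nat list \<Rightarrow> bool" where
  "same_order xs ys \<longleftrightarrow> length xs = length ys \<and>
     (\<forall>i < length xs. \<forall>j < length xs. xs ! i < xs ! j \<longleftrightarrow> ys ! i < ys ! j)"

definition contains :: "nat list \<Rightarrow> nat list \<Rightarrow> bool" where
  "contains \<sigma> \<pi> \<longleftrightarrow> (\<exists>xs. subseq xs \<sigma> \<and> same_order xs \<pi>)"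

definition avoiders :: "nat \<Rightarrow> nat list set \<Rightarrow> nat list set" where
  "avoiders n P = {\<sigma> \<in> perms_of n. \<forall>\<pi>\<in>P. \<not> contains \<sigma> \<pi>}"

definition inv_number :: "nat list \<Rightarrow> nat" where
  "inv_number \<sigma> = card {(i, j). i < j \<and> j < length \<sigma> \<and> \<sigma> ! i > \<sigma> ! j}"

definition F_inv :: "nat \<Rightarrow> nat list set \<Rightarrow> int poly" where
  "F_inv n P = (\<Sum>\<sigma>\<in>avoiders n P. monom 1 (inv_number \<sigma>))"

definition inv_Wilf_equiv :: "nat list set \<Rightarrow> nat list set \<Rightarrow> bool" where
  "inv_Wilf_equiv P P' \<longleftrightarrow> (\<forall>n. F_inv n P = F_inv n P')"

text \<open>
  Block \<open>i\<close> of an inflation is \<open>\<sigma>\<^sub>i\<close> shifted upwards by the total length of the blocks that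
  have to lie below it in value, i.e. those at positions \<open>j\<close> with \<open>\<tau>(j) < \<tau>(i)\<close>.
\<close>

definition inflation_block :: "nat list \<Rightarrow> nat list list \<Rightarrow> nat \<Rightarrow> nat list" where
  "inflation_block \<tau> \<sigma>s i =
     map (\<lambda>v. v + (\<Sum>j | j < length \<tau> \<and> \<tau> ! j < \<tau> ! i. length (\<sigma>s ! j))) (\<sigma>s ! i)"

definition inflation :: "nat list \<Rightarrow> nat list list \<Rightarrow> nat list" where
  "inflation \<tau> \<sigma>s = concat (map (inflation_block \<tau> \<sigma>s) [0..<length \<tau>])"

definition iota :: "nat \<Rightarrow> nat list" where
  "iota r = [1..<Suc r]"

definition star :: "nat list \<Rightarrow> nat list" where
  "star \<pi> = inflation [2, 1] [\<pi>, [1]]"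

lemma sum_filter_lessThan:
  "(\<Sum>j | j < (n::nat) \<and> P j. f j) = (\<Sum>j<n. if P j then f j else (0::nat))"
  using sum.inter_filter[where A = "{..<n}" and g = f and P = P] by simp

lemma star_eq: "star \<pi> = map Suc \<pi> @ [1]"
  by (simp add: star_def inflation_def inflation_block_def sum_filter_lessThan lessThan_Suc)

lemma same_order_inflation_block: "same_order (inflation_block \<tau> \<sigma>s i) (\<sigma>s ! i)"
  by (simp add: same_order_def inflation_block_def)

lemma permsD:
  assumes "\<sigma> \<in> perms"
  shows "distinct \<sigma>" "set \<sigma> = {1..length \<sigma>}"
proof -
  from assms obtain n where n: "distinct \<sigma>" "set \<sigma> = {1..n}"
    unfolding perms_def perms_of_def permutations_of_set_def by blast
  show "distinct \<sigma>" by (fact n(1))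
  have "length \<sigma> = n"
    using distinct_card[OF n(1)] unfolding n(2) by simp
  thus "set \<sigma> = {1..length \<sigma>}" by (simp only: n(2))
qed

lemma inflation_block_less:
  assumes "\<forall>k < length \<tau>. \<sigma>s ! k \<in> perms"
    and "i < length \<tau>" "j < length \<tau>" "\<tau> ! i < \<tau> ! j"
    and "x \<in> set (inflation_block \<tau> \<sigma>s i)" "y \<in> set (inflation_block \<tau> \<sigma>s j)"
  shows "x < y"
proof -
  define off where "off i = (\<Sum>j | j < length \<tau> \<and> \<tau> ! j < \<tau> ! i. length (\<sigma>s ! j))" for i
  have "length (\<sigma>s ! i) + off i =
      (\<Sum>k \<in> insert i {k. k < length \<tau> \<and> \<tau> ! k < \<tau> ! i}. length (\<sigma>s ! k))"
    by (simp add: off_def)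
  also have "\<dots> \<le> off j"
    unfolding off_def using assms by (intro sum_mono2) auto
  finally have "length (\<sigma>s ! i) + off i \<le> off j" .
  moreover have "x \<le> length (\<sigma>s ! i) + off i"
    using assms permsD(2)[of "\<sigma>s ! i"] by (auto simp: inflation_block_def off_def)
  moreover have "y > off j"
    using assms permsD(2)[of "\<sigma>s ! j"] by (auto simp: inflation_block_def off_def)
  ultimately show ?thesis by linarith
qed

lemma length_inflation:
  "length (inflation \<tau> \<sigma>s) = (\<Sum>j<length \<tau>. length (\<sigma>s ! j))"
proof -
  have "length (concat (map (inflation_block \<tau> \<sigma>s) [0..<n])) = (\<Sum>j<n. length (\<sigma>s ! j))" for n
    by (induction n) (simp_all add: inflation_block_def)
  thus ?thesis by (simp add: inflation_def)
qed

lemma inflation_perms: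
  assumes \<tau>: "distinct \<tau>" and \<sigma>s: "\<forall>k < length \<tau>. \<sigma>s ! k \<in> perms"
  shows "inflation \<tau> \<sigma>s \<in> perms"
proof -
  let ?b = "inflation_block \<tau> \<sigma>s"
  have disj: "set (?b i) \<inter> set (?b j) = {}" if "i < length \<tau>" "j < length \<tau>" "i \<noteq> j" for i j
  proof -
    have "\<tau> ! i \<noteq> \<tau> ! j"
      using \<tau> that by (simp add: nth_eq_iff_index_eq)
    then consider "\<tau> ! i < \<tau> ! j" | "\<tau> ! j < \<tau> ! i"
      using linorder_neqE_nat by blast
    moreover have False if "x \<in> set (?b i)" "x \<in> set (?b j)" "\<tau> ! i < \<tau> ! j" for x
      using inflation_block_less[OF \<sigma>s \<open>i < length \<tau>\<close> \<open>j < length \<tau>\<close> that(3,1,2)] by simp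
    moreover have False if "x \<in> set (?b i)" "x \<in> set (?b j)" "\<tau> ! j < \<tau> ! i" for x
      using inflation_block_less[OF \<sigma>s \<open>j < length \<tau>\<close> \<open>i < length \<tau>\<close> that(3,2,1)] by simp
    ultimately show ?thesis by blast
  qed
  have d: "distinct (?b i)" if "i < length \<tau>" for i
    using permsD(1)[of "\<sigma>s ! i"] \<sigma>s that
    by (auto simp: inflation_block_def distinct_map inj_on_def)
  have gen: "distinct (concat (map ?b [0..<n]))" if "n \<le> length \<tau>" for n
    using that
  proof (induction n)
    case (Suc n)
    have "set (concat (map ?b [0..<n])) \<inter> set (?b n) = {}"
    proof -
      have "set (?b i) \<inter> set (?b n) = {}" if "i < n" for i
        using disj[of i n] Suc.prems that by simp
      thus ?thesis by (auto simp: disjoint_iff)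
    qed
    moreover have "distinct (concat (map ?b [0..<n]))" "distinct (?b n)"
      using Suc d[of n] by simp_all
    ultimately show ?case by simp
  qed simp
  have dist: "distinct (inflation \<tau> \<sigma>s)"
    unfolding inflation_def by (rule gen) simp
  let ?N = "length (inflation \<tau> \<sigma>s)"
  have "set (inflation \<tau> \<sigma>s) \<subseteq> {1..?N}"
  proof
    fix x assume "x \<in> set (inflation \<tau> \<sigma>s)"
    then obtain i where i: "i < length \<tau>" "x \<in> set (?b i)"
      by (auto simp: inflation_def)
    let ?J = "{j. j < length \<tau> \<and> \<tau> ! j < \<tau> ! i}"
    from i obtain v where v: "v \<in> set (\<sigma>s ! i)" "x = v + (\<Sum>j\<in>?J. length (\<sigma>s ! j))"
      by (auto simp: inflation_block_def)
    have v': "v \<ge> 1" "v \<le> length (\<sigma>s ! i)"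
      using v permsD(2)[of "\<sigma>s ! i"] \<sigma>s i by auto
    have "length (\<sigma>s ! i) + (\<Sum>j\<in>?J. length (\<sigma>s ! j)) = (\<Sum>j\<in>insert i ?J. length (\<sigma>s ! j))"
      by simp
    also have "\<dots> \<le> ?N"
      unfolding length_inflation using i by (intro sum_mono2) auto
    finally have "x \<le> ?N" using v(2) v'(2) by linarith
    moreover have "1 \<le> x" using v(2) v'(1) by linarith
    ultimately show "x \<in> {1..?N}" by (rule atLeastAtMost_iff[THEN iffD2, OF conjI, rotated])
  qed
  moreover have "card (set (inflation \<tau> \<sigma>s)) = card {1..?N}"
    using distinct_card[OF dist] by simp
  ultimately have "set (inflation \<tau> \<sigma>s) = {1..?N}"
    by (intro card_subset_eq) simp_all
  hence "inflation \<tau> \<sigma>s \<in> perms_of ?N"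
    using dist unfolding perms_of_def permutations_of_set_def by blast
  thus ?thesis
    unfolding perms_def by blast
qed

lemma "inflation [2, 1, 3] [[1, 2, 3], [1], [2, 1]] = [2, 3, 4, 1, 6, 5]"
  by (simp add: inflation_def inflation_block_def sum_filter_lessThan lessThan_Suc)

end

theory Submission
  imports Defs
begin

text \<open>
  A 312-avoider of length \<open>n + 1\<close> is uniquely \<open>A\<^sub>* \<oplus> B\<close> with \<open>A\<close>, \<open>B\<close> 312-avoiding,
  and then \<open>inv\<close> equals \<open>inv A + |A| + inv B\<close>. As a block \<open>\<pi>\<^sub>i\<^sub>*\<close> ends with its
  minimum, an occurrence of \<open>\<pi> = \<pi>\<^sub>1\<^sub>* \<oplus> \<dots> \<oplus> \<pi>\<^sub>r\<^sub>*\<close> in \<open>A\<^sub>* \<oplus> B\<close> puts the first \<open>j\<close> blocks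
  into \<open>A\<^sub>*\<close> and the others into \<open>B\<close>, where \<open>j\<close> may be taken maximal. Moreover \<open>A\<^sub>*\<close> contains the
  sum of the first \<open>j\<close> blocks iff \<open>A\<close> contains \<open>\<pi>\<^sub>1\<close> (for \<open>j = 1\<close>), or iff \<open>A\<close> contains that
  sum (for \<open>j \<ge> 2\<close>). Hence the generating function of length \<open>n + 1\<close> is determined by those of
  \<open>{312, \<pi>\<^sub>1}\<close> and, at smaller lengths, those of \<open>312\<close> with a sum of consecutive blocks;
  induction on \<open>n\<close> finishes the proof.
\<close>

text \<open>Otherwise \<open>simp\<close> rewrites the pattern \<open>[3, 1, 2]\<close> to \<open>[3, Suc 0, 2]\<close>.\<close>

declare One_nat_def [simp del]

section \<open>Permutations and order isomorphism\<close>

lemma perms_of_iff: "\<sigma> \<in> perms_of n \<longleftrightarrow> distinct \<sigma> \<and> set \<sigma> = {1..n}"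
  by (auto simp: perms_of_def permutations_of_set_def)

lemma length_perms_of: "\<sigma> \<in> perms_of n \<Longrightarrow> length \<sigma> = n"
  using distinct_card[of \<sigma>] by (simp add: perms_of_iff)

lemma perms_iff: "\<sigma> \<in> perms \<longleftrightarrow> distinct \<sigma> \<and> set \<sigma> = {1..length \<sigma>}"
proof
  assume "distinct \<sigma> \<and> set \<sigma> = {1..length \<sigma>}"
  hence "\<sigma> \<in> perms_of (length \<sigma>)" unfolding perms_of_iff .
  thus "\<sigma> \<in> perms" unfolding perms_def by blast
qed (use permsD in blast)

lemma perms_of_subset: "\<sigma> \<in> perms_of n \<Longrightarrow> \<sigma> \<in> perms"
  by (auto simp: perms_def)

lemma subseq_set_subset: "subseq xs ys \<Longrightarrow> set xs \<subseteq> set ys"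
  by (auto simp: subseq_conv_nths dest: in_set_nthsD)

lemma strict_mono_Suc_nat: "strict_mono Suc"
  by (simp add: strict_mono_def)

text \<open>Replaces positions by the set of matched pairs of entries. For a concatenation this set
  is a union, so splitting and joining occurrences needs no index arithmetic.\<close>

lemma same_order_iff_zip:
  "same_order xs ys \<longleftrightarrow> length xs = length ys \<and>
     (\<forall>a \<in> set (zip xs ys). \<forall>b \<in> set (zip xs ys). fst a < fst b \<longleftrightarrow> snd a < snd b)"
proof (cases "length xs = length ys")
  case True
  hence "(\<forall>a \<in> set (zip xs ys). P a) \<longleftrightarrow> (\<forall>i < length xs. P (xs ! i, ys ! i))" for P
    by (auto simp: set_zip)
  with True show ?thesis by (simp add: same_order_def)
qed (simp add: same_order_def)

lemma same_order_sym: "same_order xs ys \<Longrightarrow> same_order ys xs"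
  by (auto simp: same_order_def)

lemma same_order_trans: "same_order xs ys \<Longrightarrow> same_order ys zs \<Longrightarrow> same_order xs zs"
  by (auto simp: same_order_def)

lemma same_order_map: "strict_mono f \<Longrightarrow> same_order (map f xs) xs"
  by (auto simp: same_order_def strict_mono_less)

lemma same_order_appendD:
  assumes "same_order (xs @ xs') (ys @ ys')" "length xs = length ys"
  shows "same_order xs ys" "same_order xs' ys'"
proof -
  have zip: "set (zip (xs @ xs') (ys @ ys')) = set (zip xs ys) \<union> set (zip xs' ys')"
    using assms(2) by simp
  have "length xs' = length ys'" using assms by (simp add: same_order_def)
  with assms show "same_order xs ys" "same_order xs' ys'"
    unfolding same_order_iff_zip zip by (metis UnCI)+
qed

text \<open>\<open>cross\<close> ranges over all entries of the four lists, not only over matched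
  ones; this suffices because it is applied only when one part lies entirely above the other in
  value. Both directions of the comparison appear since \<open>same_order\<close> tests only
  \<open><\<close>, on ordered pairs.\<close>

lemma same_order_append:
  assumes "same_order xs ys" "same_order xs' ys'"
    and cross: "\<And>x x' y y'. x \<in> set xs \<Longrightarrow> x' \<in> set xs' \<Longrightarrow> y \<in> set ys \<Longrightarrow> y' \<in> set ys' \<Longrightarrow>
      (x < x' \<longleftrightarrow> y < y') \<and> (x' < x \<longleftrightarrow> y' < y)"
  shows "same_order (xs @ xs') (ys @ ys')"
proof -
  have len: "length xs = length ys" "length xs' = length ys'"
    using assms by (auto simp: same_order_def)
  let ?Z = "set (zip xs ys)" and ?Z' = "set (zip xs' ys')"
  have diag: "fst a < fst b \<longleftrightarrow> snd a < snd b" if "a \<in> ?Z \<and> b \<in> ?Z \<or> a \<in> ?Z' \<and> b \<in> ?Z'" for a b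
    using that assms(1,2) unfolding same_order_iff_zip by metis
  have off: "(fst a < fst b \<longleftrightarrow> snd a < snd b) \<and> (fst b < fst a \<longleftrightarrow> snd b < snd a)"
    if "a \<in> ?Z" "b \<in> ?Z'" for a b
    using that by (intro cross) (metis prod.collapse set_zip_leftD set_zip_rightD)+
  have "fst a < fst b \<longleftrightarrow> snd a < snd b" if "a \<in> ?Z \<union> ?Z'" "b \<in> ?Z \<union> ?Z'" for a b
    using that diag[of a b] off[of a b] off[of b a] by (elim UnE) simp_all
  thus ?thesis
    unfolding same_order_iff_zip zip_append[OF len(1)] set_append by (simp add: len)
qed

text \<open>Carries a comparison across the cut from the second list back to the first:
  \<open>x\<close> and \<open>x'\<close> are the entries matched with \<open>y\<close> and
  \<open>y'\<close>.\<close>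

lemma same_order_append_cross:
  assumes "same_order (xs @ xs') (ys @ ys')" "length xs = length ys"
    and "y \<in> set ys" "y' \<in> set ys'"
  obtains x x' where "x \<in> set xs" "x' \<in> set xs'" "x < x' \<longleftrightarrow> y < y'"
proof -
  have len: "length xs' = length ys'" using assms(1,2) by (auto simp: same_order_def)
  obtain x where x: "(x, y) \<in> set (zip xs ys)"
    using assms(2,3) by (metis in_set_impl_in_set_zip2)
  obtain x' where x': "(x', y') \<in> set (zip xs' ys')"
    using len assms(4) by (metis in_set_impl_in_set_zip2)
  have "x < x' \<longleftrightarrow> y < y'"
    using assms(1,2) x x' unfolding same_order_iff_zip
    by (metis Un_iff fst_conv snd_conv set_append zip_append)
  with that x x' show ?thesis by (meson set_zip_leftD)
qed

section \<open>Pattern containment\<close>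

lemma contains_Nil [simp]: "contains \<sigma> []"
  by (auto simp: contains_def same_order_def intro!: exI[of _ "[]"])

lemma contains_Nil_left: "contains [] \<pi> \<longleftrightarrow> \<pi> = []"
  by (auto simp: contains_def same_order_def dest: list_emb_Nil2)

lemma contains_same_order_right: "same_order \<pi> \<rho> \<Longrightarrow> contains \<sigma> \<pi> \<Longrightarrow> contains \<sigma> \<rho>"
  unfolding contains_def using same_order_trans by blast

lemma contains_map_right: "strict_mono f \<Longrightarrow> contains \<sigma> (map f \<pi>) \<longleftrightarrow> contains \<sigma> \<pi>"
  using contains_same_order_right same_order_map same_order_sym by blast

lemma contains_map_left:
  assumes "strict_mono f"
  shows "contains (map f \<sigma>) \<pi> \<longleftrightarrow> contains \<sigma> \<pi>"
proof
  assume "contains (map f \<sigma>) \<pi>"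
  then obtain xs where xs: "subseq xs (map f \<sigma>)" "same_order xs \<pi>" by (auto simp: contains_def)
  then obtain N where "xs = map f (nths \<sigma> N)" by (auto simp: subseq_conv_nths nths_map)
  with xs show "contains \<sigma> \<pi>"
    using same_order_map[OF assms, of "nths \<sigma> N"] same_order_sym same_order_trans
    unfolding contains_def by (metis subseq_conv_nths)
next
  assume "contains \<sigma> \<pi>"
  thus "contains (map f \<sigma>) \<pi>"
    unfolding contains_def using same_order_map[OF assms] same_order_trans subseq_map by blast
qed

lemma contains_subseq: "contains xs \<pi> \<Longrightarrow> subseq xs ys \<Longrightarrow> contains ys \<pi>"
  unfolding contains_def using subseq_order.trans by blast

text \<open>Cutting an occurrence after \<open>length \<pi>\<close> entries leaves an occurrence of
  each part.\<close>

lemma contains_appendD: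
  assumes "contains \<sigma> (\<pi> @ \<rho>)"
  shows "contains \<sigma> \<pi>" "contains \<sigma> \<rho>"
proof -
  obtain xs where xs: "subseq xs \<sigma>" "same_order xs (\<pi> @ \<rho>)" using assms by (auto simp: contains_def)
  let ?a = "take (length \<pi>) xs" and ?b = "drop (length \<pi>) xs"
  have len: "length ?a = length \<pi>" using xs by (auto simp: same_order_def)
  have ab: "?a @ ?b = xs" by simp
  have "same_order (?a @ ?b) (\<pi> @ \<rho>)" unfolding ab by (rule xs(2))
  from same_order_appendD[OF this len] have *: "same_order ?a \<pi>" "same_order ?b \<rho>" .
  have "subseq ?a (?a @ ?b)" "subseq ?b (?a @ ?b)"
    by (intro list_emb_append2 subseq_order.refl list_emb_prefix)+
  hence "subseq ?a \<sigma>" "subseq ?b \<sigma>"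
    unfolding ab using xs(1) subseq_order.trans by blast+
  with * show "contains \<sigma> \<pi>" "contains \<sigma> \<rho>" unfolding contains_def by blast+
qed

section \<open>Direct sums, stars and the pattern of the theorem\<close>

definition dsum :: "nat list \<Rightarrow> nat list \<Rightarrow> nat list" where
  "dsum xs ys = xs @ map (\<lambda>v. v + length xs) ys"

lemma strict_mono_add_nat: "strict_mono (\<lambda>v::nat. v + c)"
  by (simp add: strict_mono_def)

lemma length_dsum [simp]: "length (dsum xs ys) = length xs + length ys"
  by (simp add: dsum_def)

lemma dsum_Nil [simp]: "dsum [] ys = ys" "dsum xs [] = xs"
  by (simp_all add: dsum_def)

lemma dsum_assoc: "dsum (dsum xs ys) zs = dsum xs (dsum ys zs)"
  by (simp add: dsum_def add_ac)

lemma dsum_perms: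
  assumes "xs \<in> perms" "ys \<in> perms"
  shows "dsum xs ys \<in> perms"
proof -
  have "(\<lambda>v. v + length xs) ` {1..length ys} = {length xs + 1..length xs + length ys}"
    by (simp add: add_ac)
  with assms show ?thesis
    by (auto simp: perms_iff dsum_def distinct_map inj_on_def)
qed

lemma length_star [simp]: "length (star \<pi>) = Suc (length \<pi>)"
  by (simp add: star_eq)

lemma star_perms:
  assumes "\<pi> \<in> perms"
  shows "star \<pi> \<in> perms"
proof -
  have "Suc ` {1..length \<pi>} = {2..Suc (length \<pi>)}" by (simp add: image_Suc_atLeastAtMost)
  with assms show ?thesis
    by (auto simp: perms_iff star_eq distinct_map)
qed

text \<open>The pattern of the theorem as a function of its list of blocks: prefixes and suffixes of
  the list give patterns of the same kind, which the recursion requires.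
  \<open>inflation_iota_star\<close> links it to the inflation.\<close>

definition star_sum :: "nat list list \<Rightarrow> nat list" where
  "star_sum ps = foldr (\<lambda>p. dsum (star p)) ps []"

lemma star_sum_simps [simp]:
  "star_sum [] = []" "star_sum (p # ps) = dsum (star p) (star_sum ps)"
  by (simp_all add: star_sum_def)

lemma star_sum_append: "star_sum (ps @ qs) = dsum (star_sum ps) (star_sum qs)"
  by (induction ps) (simp_all add: dsum_assoc)

lemma star_sum_perms: "set ps \<subseteq> perms \<Longrightarrow> star_sum ps \<in> perms"
proof (induction ps)
  case Nil
  show ?case by (simp add: perms_iff)
qed (auto intro: dsum_perms star_perms)

lemma length_iota [simp]: "length (iota r) = r"
  by (simp add: iota_def del: upt_Suc)

text \<open>As \<open>iota\<close> increases, the blocks below block \<open>i\<close> are exactly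
  the earlier ones, so its offset is their total length. Appending a last block leaves all earlier
  offsets unchanged, hence the induction from the right.\<close>

lemma inflation_iota: "inflation (iota (length qs)) qs = foldr dsum qs []"
proof -
  have block: "inflation_block (iota r) qs i = map (\<lambda>v. v + (\<Sum>j<i. length (qs ! j))) (qs ! i)"
    if "i < r" for r i qs
  proof -
    have "{j. j < length (iota r) \<and> iota r ! j < iota r ! i} = {..<i}"
      using that by (auto simp: iota_def simp del: upt_Suc)
    thus ?thesis by (simp add: inflation_block_def)
  qed
  have foldr_append: "foldr dsum (xs @ ys) [] = dsum (foldr dsum xs []) (foldr dsum ys [])" for xs ys
    by (induction xs) (simp_all add: dsum_assoc)
  show ?thesis
  proof (induction qs rule: rev_induct)
    case (snoc q qs)
    let ?n = "length qs"
    have "inflation_block (iota (Suc ?n)) (qs @ [q]) i = inflation_block (iota ?n) qs i" if "i < ?n" for i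
      using that by (simp add: block nth_append)
    hence "map (inflation_block (iota (Suc ?n)) (qs @ [q])) [0..<?n]
        = map (inflation_block (iota ?n) qs) [0..<?n]"
      by simp
    hence "inflation (iota (Suc ?n)) (qs @ [q])
        = foldr dsum qs [] @ inflation_block (iota (Suc ?n)) (qs @ [q]) ?n"
      unfolding snoc.IH[symmetric] inflation_def length_iota by (simp only: upt_Suc_append concat_append map_append list.map concat.simps append_Nil2 le0)
    moreover have "length (foldr dsum qs []) = (\<Sum>j<?n. length (qs ! j))"
      unfolding snoc.IH[symmetric] length_inflation by simp
    moreover have "inflation_block (iota (Suc ?n)) (qs @ [q]) ?n
        = map (\<lambda>v. v + (\<Sum>j<?n. length (qs ! j))) q"
      by (simp add: block nth_append)
    ultimately have "inflation (iota (Suc ?n)) (qs @ [q]) = dsum (foldr dsum qs []) q"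
      by (simp only: dsum_def)
    thus ?case unfolding foldr_append by simp
  qed (simp add: inflation_def iota_def)
qed

lemma inflation_iota_star:
  "inflation (iota r) (map (\<lambda>i. star (p i)) [1..<Suc r]) = star_sum (map p [1..<Suc r])"
proof -
  let ?qs = "map (\<lambda>i. star (p i)) [1..<Suc r]"
  have "inflation (iota (length ?qs)) ?qs = foldr dsum ?qs []" by (rule inflation_iota)
  moreover have "length ?qs = r" by (simp del: upt_Suc)
  ultimately show ?thesis by (simp only: star_sum_def foldr_map comp_def)
qed

text \<open>A cut of a sum of stars with all values on the left below all values on the right can only
  fall between two blocks, since each block ends with its minimum.\<close>

lemma star_sum_cut:
  assumes "set ps \<subseteq> perms" "star_sum ps = U @ V"
    and "\<And>u v. u \<in> set U \<Longrightarrow> v \<in> set V \<Longrightarrow> u < v"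
  shows "\<exists>j\<le>length ps. U = star_sum (take j ps) \<and> V = map (\<lambda>v. v + length U) (star_sum (drop j ps))"
  using assms
proof (induction ps arbitrary: U V)
  case (Cons p ps)
  show ?case
  proof (cases "U = []")
    case True
    thus ?thesis using Cons.prems(2) by (intro exI[of _ 0]) simp
  next
    case False
    let ?s = "\<lambda>v. v + length (star p)"
    have eq: "star p @ map ?s (star_sum ps) = U @ V"
      using Cons.prems(2) by (simp add: dsum_def)
    have pos: "u \<ge> 1" if "u \<in> set (U @ V)" for u
    proof -
      have "U @ V \<in> perms" using star_sum_perms Cons.prems(1,2) by metis
      thus ?thesis using that permsD(2) by (metis atLeastAtMost_iff)
    qed
    show ?thesis
    \<comment> \<open>A cut strictly inside \<open>star p\<close> puts the final 1 of
      \<open>star p\<close> into \<open>V\<close>, although the nonempty \<open>U\<close> has only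
      entries of at least 1.\<close>
    proof (cases "length U < length (star p)")
      case True
      have "star p = U @ take (length (star p) - length U) V"
        using arg_cong[OF eq, of "take (length (star p))"] True by (simp del: length_star)
      moreover from this True have "take (length (star p) - length U) V \<noteq> []"
        by (metis append_Nil2 less_irrefl)
      ultimately have "last (star p) \<in> set (take (length (star p) - length U) V)"
        by (metis last_appendR last_in_set)
      hence "1 \<in> set V"
        by (metis in_set_takeD last_snoc star_eq)
      moreover have "hd U \<in> set U" using False by simp
      ultimately show ?thesis using Cons.prems(3)[of "hd U" 1] pos[of "hd U"] by simp
    next
      case len: False
      \<comment> \<open>The cut lies at or after the end of \<open>star p\<close>; removing this
        block and its shift gives a cut of the remaining sum.\<close>
      let ?U' = "take (length U - length (star p)) (star_sum ps)"
      let ?V' = "drop (length U - length (star p)) (star_sum ps)"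
      have U: "U = star p @ map ?s ?U'"
        using arg_cong[OF eq, of "take (length U)"] len by (simp add: take_map)
      have V: "V = map ?s ?V'"
        using arg_cong[OF eq, of "drop (length U)"] len by (simp add: drop_map)
      have "\<exists>j\<le>length ps. ?U' = star_sum (take j ps) \<and>
          ?V' = map (\<lambda>v. v + length ?U') (star_sum (drop j ps))"
      proof (rule Cons.IH)
        fix u v assume "u \<in> set ?U'" "v \<in> set ?V'"
        hence "?s u \<in> set U" "?s v \<in> set V" by (subst U V; simp)+
        thus "u < v" using Cons.prems(3) by fastforce
      qed (use Cons.prems in auto)
      then obtain j where j: "j \<le> length ps" "?U' = star_sum (take j ps)"
        "?V' = map (\<lambda>v. v + length ?U') (star_sum (drop j ps))" by blast
      have "length U = length ?U' + length (star p)" by (subst U) simp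
      hence "V = map (\<lambda>v. v + length U) (star_sum (drop j ps))"
        unfolding V by (subst j(3)) (simp only: map_map comp_def add.assoc)
      moreover have "U = star_sum (take (Suc j) (p # ps))"
        by (subst U, subst j(2)) (simp add: dsum_def)
      ultimately show ?thesis using j(1) by (intro exI[of _ "Suc j"]) simp
    qed
  qed
qed simp

section \<open>Occurrences of sums of stars in direct sums and in stars\<close>

lemma dsum_less:
  assumes "S \<in> perms" "B \<in> perms" "u \<in> set S" "v \<in> set (map (\<lambda>v. v + length S) B)"
  shows "u < v"
proof -
  obtain w where "w \<in> set B" "v = w + length S" using assms(4) by auto
  moreover from this have "1 \<le> w" using permsD(2)[OF assms(2)] by (metis atLeastAtMost_iff)
  moreover have "u \<le> length S" using assms(3) permsD(2)[OF assms(1)] by (metis atLeastAtMost_iff)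
  ultimately show ?thesis by linarith
qed

text \<open>An occurrence splits into entries from \<open>S\<close> followed by larger entries from
  \<open>B\<close>. The pattern is thereby cut into a lower left and an upper right part, and
  \<open>star_sum_cut\<close> places the cut between blocks. Conversely, occurrences in
  \<open>S\<close> and in \<open>B\<close> concatenate.\<close>

lemma contains_dsum_star_sum:
  assumes "S \<in> perms" "B \<in> perms" "set ps \<subseteq> perms"
  shows "contains (dsum S B) (star_sum ps) \<longleftrightarrow>
    (\<exists>j\<le>length ps. contains S (star_sum (take j ps)) \<and> contains B (star_sum (drop j ps)))"
proof
  let ?s = "\<lambda>v. v + length S"
  assume "contains (dsum S B) (star_sum ps)"
  then obtain xs where "subseq xs (S @ map ?s B)" and so: "same_order xs (star_sum ps)"
    by (auto simp: contains_def dsum_def)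
  then obtain ys zs where xs: "xs = ys @ zs" and ys: "subseq ys S" and zs: "subseq zs (map ?s B)"
    by (auto elim: subseq_appendE)
  let ?U = "take (length ys) (star_sum ps)" and ?V = "drop (length ys) (star_sum ps)"
  have so': "same_order (ys @ zs) (?U @ ?V)" using so xs by simp
  have len: "length ys = length ?U" using so xs by (auto simp: same_order_def)
  have "\<exists>j\<le>length ps. ?U = star_sum (take j ps) \<and> ?V = map (\<lambda>v. v + length ?U) (star_sum (drop j ps))"
  proof (rule star_sum_cut)
    fix u v assume "u \<in> set ?U" "v \<in> set ?V"
    from same_order_append_cross[OF so' len this] obtain x x'
      where x: "x \<in> set ys" "x' \<in> set zs" "x < x' \<longleftrightarrow> u < v" .
    hence "x \<in> set S" "x' \<in> set (map ?s B)" using ys zs subseq_set_subset by blast+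
    thus "u < v" using dsum_less[OF assms(1,2)] x(3) by blast
  qed (use assms in auto)
  then obtain j where j: "j \<le> length ps" "?U = star_sum (take j ps)"
    "?V = map (\<lambda>v. v + length ?U) (star_sum (drop j ps))" by blast
  have "contains S ?U" "contains (map ?s B) ?V"
    using same_order_appendD[OF so' len] ys zs by (auto simp: contains_def)
  hence "contains S (star_sum (take j ps))" "contains B (star_sum (drop j ps))"
    unfolding j(2) j(3) contains_map_left[OF strict_mono_add_nat] contains_map_right[OF strict_mono_add_nat] .
  with j(1) show "\<exists>j\<le>length ps. contains S (star_sum (take j ps)) \<and> contains B (star_sum (drop j ps))"
    by blast
next
  let ?s = "\<lambda>v. v + length S"
  assume "\<exists>j\<le>length ps. contains S (star_sum (take j ps)) \<and> contains B (star_sum (drop j ps))"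
  then obtain j where j: "contains S (star_sum (take j ps))" "contains B (star_sum (drop j ps))" by blast
  let ?P = "star_sum (take j ps)" and ?Q = "star_sum (drop j ps)"
  have perms: "?P \<in> perms" "?Q \<in> perms"
    using assms(3) by (intro star_sum_perms; meson order_trans set_take_subset set_drop_subset)+
  from j(2) have "contains (map ?s B) (map (\<lambda>v. v + length ?P) ?Q)"
    unfolding contains_map_left[OF strict_mono_add_nat] contains_map_right[OF strict_mono_add_nat] .
  with j(1) obtain ys zs where *: "subseq ys S" "same_order ys ?P" "subseq zs (map ?s B)"
    "same_order zs (map (\<lambda>v. v + length ?P) ?Q)" by (auto simp: contains_def)
  have "same_order (ys @ zs) (?P @ map (\<lambda>v. v + length ?P) ?Q)"
  proof (rule same_order_append)
    fix x x' y y' assume "x \<in> set ys" "x' \<in> set zs"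
      "y \<in> set ?P" "y' \<in> set (map (\<lambda>v. v + length ?P) ?Q)"
    hence "x < x'" "y < y'"
      using *(1,3) dsum_less[OF assms(1,2)] dsum_less[OF perms] subseq_set_subset by blast+
    thus "(x < x' \<longleftrightarrow> y < y') \<and> (x' < x \<longleftrightarrow> y' < y)" by simp
  qed (fact *)+
  moreover have "subseq (ys @ zs) (S @ map ?s B)" using *(1,3) by (rule list_emb_append_mono)
  ultimately have "contains (dsum S B) (dsum ?P ?Q)" by (auto simp: contains_def dsum_def)
  thus "contains (dsum S B) (star_sum ps)" unfolding star_sum_append[symmetric] by simp
qed

text \<open>All but the last entry of an occurrence precede the final 1 of \<open>star A\<close>,
  hence lie in \<open>map Suc A\<close>. Conversely, that 1 completes an occurrence of
  \<open>p\<close> as its new last minimum.\<close>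

lemma contains_star_star:
  assumes "A \<in> perms" "p \<in> perms"
  shows "contains (star A) (star p) \<longleftrightarrow> contains A p"
proof
  assume "contains (star A) (star p)"
  then obtain xs where xs: "subseq xs (map Suc A @ [1])" "same_order xs (map Suc p @ [1])"
    by (auto simp: contains_def star_eq)
  from xs(1) obtain ys zs where ys: "xs = ys @ zs" "subseq ys (map Suc A)" "subseq zs [1]"
    by (auto elim: subseq_appendE)
  have "length zs \<le> 1" using ys(3) list_emb_length by fastforce
  hence "length (butlast xs) \<le> length ys" by (simp add: ys(1))
  hence "butlast xs = take (length (butlast xs)) ys"
    unfolding ys(1) by (simp add: butlast_conv_take)
  hence "subseq (butlast xs) (map Suc A)"
    using ys(2) by (metis append_take_drop_id list_emb_append2 list_emb_prefix subseq_append' subseq_order.refl subseq_order.trans)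
  moreover have "xs \<noteq> []" using xs(2) by (auto simp: same_order_def)
  hence "same_order (butlast xs @ [last xs]) (map Suc p @ [1])" using xs(2) by simp
  hence "same_order (butlast xs) (map Suc p)"
    by (rule same_order_appendD) (use xs(2) in \<open>auto simp: same_order_def\<close>)
  ultimately have "contains (map Suc A) (map Suc p)" by (auto simp: contains_def)
  thus "contains A p" by (simp add: contains_map_left contains_map_right strict_mono_Suc_nat)
next
  assume "contains A p"
  hence "contains (map Suc A) (map Suc p)"
    by (simp add: contains_map_left contains_map_right strict_mono_Suc_nat)
  then obtain xs where xs: "subseq xs (map Suc A)" "same_order xs (map Suc p)"
    by (auto simp: contains_def)
  have "same_order (xs @ [1]) (map Suc p @ [1])"
  proof (rule same_order_append)
    fix x x' y y' :: nat
    assume *: "x \<in> set xs" "x' \<in> set [1]" "y \<in> set (map Suc p)" "y' \<in> set [1]"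
    have "set xs \<subseteq> Suc ` set A" using xs(1) subseq_set_subset by fastforce
    with * have "x' < x" "y' < y"
      using permsD(2)[OF assms(1)] permsD(2)[OF assms(2)] by auto
    thus "(x < x' \<longleftrightarrow> y < y') \<and> (x' < x \<longleftrightarrow> y' < y)" by simp
  qed (use xs in \<open>auto simp: same_order_def\<close>)
  moreover have "subseq (xs @ [1]) (map Suc A @ [1])"
    using xs(1) by (intro list_emb_append_mono) auto
  ultimately show "contains (star A) (star p)" unfolding contains_def star_eq by blast
qed

text \<open>With two or more blocks, the last entry of the pattern exceeds an earlier one, namely
  the 1 that ends the first block. The final 1 of \<open>star A\<close>, being the minimum, cannot
  play that role, so it takes no part in any occurrence.\<close>

lemma contains_star_star_sum:
  assumes "A \<in> perms" "set (p # p' # ps) \<subseteq> perms"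
  shows "contains (star A) (star_sum (p # p' # ps)) \<longleftrightarrow> contains A (star_sum (p # p' # ps))"
    (is "_ \<longleftrightarrow> contains A ?\<pi>")
proof
  assume "contains (star A) ?\<pi>"
  then obtain xs where xs: "subseq xs (map Suc A @ [1])" "same_order xs ?\<pi>"
    by (auto simp: contains_def star_eq)
  from xs(1) obtain ys zs where ys: "xs = ys @ zs" "subseq ys (map Suc A)" "subseq zs [1]"
    by (auto elim: subseq_appendE)
  have "zs = []"
  proof (rule ccontr)
    assume "zs \<noteq> []"
    with ys(3) have zs: "zs = [1]"
      by (auto elim!: list_emb.cases[of _ zs] simp: list_emb_Nil2)
    let ?P = "star p" and ?Q = "star_sum (p' # ps)"
    let ?Q' = "map (\<lambda>v. v + length ?P) ?Q"
    have Q: "?Q \<noteq> []" using length_star[of p'] by (metis Zero_not_Suc length_0_conv length_dsum add_Suc star_sum_simps(2))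
    hence \<pi>: "?\<pi> = (?P @ butlast ?Q') @ [last ?Q']" by (simp add: dsum_def del: star_sum_simps(2)) (simp add: dsum_def)
    have "same_order (ys @ [1]) ((?P @ butlast ?Q') @ [last ?Q'])" using xs(2) ys(1) zs \<pi> by simp
    moreover have "length ys = length (?P @ butlast ?Q')"
      using arg_cong[OF \<pi>, of length] xs(2) ys(1) zs by (auto simp: same_order_def)
    moreover have "1 \<in> set (?P @ butlast ?Q')" by (simp add: star_eq)
    ultimately obtain x where x: "x \<in> set ys" "x < 1 \<longleftrightarrow> 1 < last ?Q'"
      by (rule same_order_append_cross[where y' = "last ?Q'"]) auto
    have "last ?Q' \<in> set ?Q'" using Q by (intro last_in_set) simp
    moreover have "?Q \<in> perms" "?P \<in> perms" using assms(2) star_sum_perms[of "p' # ps"] star_perms[of p] by auto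
    moreover have "1 \<in> set ?P" by (simp add: star_eq)
    ultimately have "1 < last ?Q'" using dsum_less by blast
    hence "x = 0" using x by simp
    moreover have "set ys \<subseteq> Suc ` set A" using ys(2) subseq_set_subset by fastforce
    ultimately show False using x(1) by auto
  qed
  with xs ys have "contains (map Suc A) ?\<pi>" by (auto simp: contains_def)
  thus "contains A ?\<pi>" by (simp only: contains_map_left strict_mono_Suc_nat)
next
  assume "contains A ?\<pi>"
  hence "contains (map Suc A) ?\<pi>" by (simp only: contains_map_left strict_mono_Suc_nat)
  thus "contains (star A) ?\<pi>" by (rule contains_subseq) (simp add: star_eq list_emb_prefix)
qed

lemma contains_star_sum_take_mono:
  assumes "contains S (star_sum (take j ps))" "i \<le> j"
  shows "contains S (star_sum (take i ps))"
proof -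
  have "take j ps = take i ps @ drop i (take j ps)"
    using assms(2) by (metis append_take_drop_id min.absorb1 take_take)
  hence "star_sum (take j ps) = dsum (star_sum (take i ps)) (star_sum (drop i (take j ps)))"
    by (metis star_sum_append)
  with assms(1) show ?thesis unfolding dsum_def using contains_appendD by metis
qed

lemma contains_star_sum_drop_mono:
  assumes "contains S (star_sum (drop i ps))" "i \<le> j"
  shows "contains S (star_sum (drop j ps))"
proof -
  have "drop i ps = take (j - i) (drop i ps) @ drop j ps"
    using assms(2) by (metis append_take_drop_id drop_drop le_add_diff_inverse2)
  hence "star_sum (drop i ps) = dsum (star_sum (take (j - i) (drop i ps))) (star_sum (drop j ps))"
    by (metis star_sum_append)
  with assms(1) show ?thesis
    unfolding dsum_def using contains_appendD(2) contains_map_right[OF strict_mono_add_nat] by metis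
qed

section \<open>Avoidance of 312 under direct sum and star\<close>

lemma contains_312_iff:
  "contains \<sigma> [3, 1, 2] \<longleftrightarrow> (\<exists>a b c. subseq [a, b, c] \<sigma> \<and> b < c \<and> c < a)"
proof
  assume "contains \<sigma> [3, 1, 2]"
  then obtain xs where xs: "subseq xs \<sigma>" "same_order xs [3, 1, 2]" by (auto simp: contains_def)
  then obtain a b c where abc: "xs = [a, b, c]"
    by (auto simp: same_order_def length_Suc_conv)
  have "b < c \<and> c < a" using xs(2) by (auto simp: abc same_order_iff_zip)
  with xs(1) abc show "\<exists>a b c. subseq [a, b, c] \<sigma> \<and> b < c \<and> c < a" by blast
next
  assume "\<exists>a b c. subseq [a, b, c] \<sigma> \<and> b < c \<and> c < a"
  then obtain a b c where "subseq [a, b, c] \<sigma>" "b < c" "c < a" by blast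
  thus "contains \<sigma> [3, 1, 2]" unfolding contains_def
    by (intro exI[of _ "[a, b, c]"]) (auto simp: same_order_iff_zip)
qed

text \<open>An occurrence \<open>a, b, c\<close> divided between the summands would have
  \<open>a\<close> in the lower and \<open>c\<close> in the upper one, against
  \<open>c < a\<close>.\<close>

lemma contains_312_dsum:
  assumes "S \<in> perms" "B \<in> perms"
  shows "contains (dsum S B) [3, 1, 2] \<longleftrightarrow> contains S [3, 1, 2] \<or> contains B [3, 1, 2]"
proof
  let ?s = "\<lambda>v. v + length S"
  assume "contains (dsum S B) [3, 1, 2]"
  then obtain a b c where abc: "subseq [a, b, c] (S @ map ?s B)" "b < c" "c < a"
    by (auto simp: contains_312_iff dsum_def)
  from abc(1) obtain ys zs where ys: "[a, b, c] = ys @ zs" "subseq ys S" "subseq zs (map ?s B)"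
    by (auto elim: subseq_appendE)
  have "\<forall>u \<in> set ys. \<forall>v \<in> set zs. u < v"
    using ys(2,3) dsum_less[OF assms] subseq_set_subset by blast
  hence "ys = [] \<or> zs = []"
    using ys(1) abc(2,3) by (auto simp: Cons_eq_append_conv)
  hence "subseq [a, b, c] S \<or> subseq [a, b, c] (map ?s B)" using ys by auto
  hence "contains S [3, 1, 2] \<or> contains (map ?s B) [3, 1, 2]"
    using abc(2,3) unfolding contains_312_iff by blast
  thus "contains S [3, 1, 2] \<or> contains B [3, 1, 2]"
    by (simp only: contains_map_left[OF strict_mono_add_nat])
next
  assume "contains S [3, 1, 2] \<or> contains B [3, 1, 2]"
  hence "contains S [3, 1, 2] \<or> contains (map (\<lambda>v. v + length S) B) [3, 1, 2]"
    by (simp only: contains_map_left[OF strict_mono_add_nat])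
  thus "contains (dsum S B) [3, 1, 2]"
    unfolding dsum_def using contains_subseq by blast
qed

text \<open>The final 1 of \<open>star A\<close> could only act as the last letter of 312, but that
  letter exceeds the middle one.\<close>

lemma contains_312_star:
  assumes "A \<in> perms"
  shows "contains (star A) [3, 1, 2] \<longleftrightarrow> contains A [3, 1, 2]"
proof
  assume "contains (star A) [3, 1, 2]"
  then obtain a b c where abc: "subseq [a, b, c] (map Suc A @ [1])" "b < c" "c < a"
    by (auto simp: contains_312_iff star_eq)
  from abc(1) obtain ys zs where ys: "[a, b, c] = ys @ zs" "subseq ys (map Suc A)" "subseq zs [1]"
    by (auto elim: subseq_appendE)
  \<comment> \<open>All entries of \<open>star A\<close> are positive, so \<open>c > b\<close> gives
    \<open>c > 1\<close>. As \<open>c\<close> comes last and is not the final 1, nothing is taken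
    from \<open>[1]\<close>.\<close>
  have "b \<noteq> 0"
    using subseq_set_subset[OF abc(1)] by auto
  hence "c \<notin> set zs" using subseq_set_subset[OF ys(3)] abc(2) by auto
  hence "zs = []" using ys(1) by (metis last_ConsL last_ConsR last_appendR last_in_set list.distinct(1))
  hence "subseq [a, b, c] (map Suc A)" using ys by simp
  hence "contains (map Suc A) [3, 1, 2]"
    using abc(2,3) unfolding contains_312_iff by blast
  thus "contains A [3, 1, 2]" by (simp only: contains_map_left strict_mono_Suc_nat)
next
  assume "contains A [3, 1, 2]"
  hence "contains (map Suc A) [3, 1, 2]" by (simp only: contains_map_left strict_mono_Suc_nat)
  thus "contains (star A) [3, 1, 2]" by (rule contains_subseq) (simp add: star_eq list_emb_prefix)
qed

section \<open>The decomposition of 312-avoiders\<close>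

abbreviation av312 :: "nat \<Rightarrow> nat list set" where
  "av312 n \<equiv> avoiders n {[3, 1, 2]}"

lemma av312_iff: "A \<in> av312 n \<longleftrightarrow> A \<in> perms \<and> length A = n \<and> \<not> contains A [3, 1, 2]"
proof -
  have "A \<in> perms_of n \<longleftrightarrow> A \<in> perms \<and> length A = n"
  proof
    assume "A \<in> perms_of n"
    thus "A \<in> perms \<and> length A = n" using perms_of_subset length_perms_of by blast
  next
    assume *: "A \<in> perms \<and> length A = n"
    hence "distinct A" "set A = {1..length A}" using permsD by blast+
    thus "A \<in> perms_of n" using * by (simp only: perms_of_iff)
  qed
  thus ?thesis unfolding avoiders_def by blast
qed

lemma finite_avoiders [simp]: "finite (avoiders n P)"
proof -
  have "finite (perms_of n)" by (simp add: perms_of_def)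
  moreover have "avoiders n P \<subseteq> perms_of n" unfolding avoiders_def by blast
  ultimately show ?thesis by (rule rev_finite_subset)
qed

lemma avoiders_312_insert: "avoiders n {[3, 1, 2], \<pi>} = {A \<in> av312 n. \<not> contains A \<pi>}"
  by (auto simp: avoiders_def)

lemma dsum_star_in_av312:
  assumes "A \<in> av312 m" "B \<in> av312 k"
  shows "dsum (star A) B \<in> av312 (Suc (m + k))"
  using assms by (simp add: av312_iff contains_312_dsum contains_312_star star_perms dsum_perms)

text \<open>Serves to identify the values to the left of 1 in a 312-avoider, with
  \<open>a = 2\<close>.\<close>

lemma down_closed_eq_atLeastAtMost:
  fixes D :: "nat set"
  assumes "finite D" "\<And>x y. x \<in> D \<Longrightarrow> a \<le> y \<Longrightarrow> y \<le> x \<Longrightarrow> y \<in> D" "\<And>x. x \<in> D \<Longrightarrow> a \<le> x"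
  shows "D = {a..<a + card D}"
proof (cases "D = {}")
  case False
  have "Max D \<in> D" using assms(1) False by (rule Max_in)
  have "D = {a..Max D}"
  proof (intro set_eqI iffI)
    fix y assume "y \<in> D"
    thus "y \<in> {a..Max D}" using assms(1,3) by simp
  next
    fix y assume "y \<in> {a..Max D}"
    thus "y \<in> D" using assms(2)[OF \<open>Max D \<in> D\<close>] by simp
  qed
  moreover from this have "card D = Suc (Max D) - a" by (metis card_atLeastAtMost)
  moreover have "a \<le> Max D" using assms(3) \<open>Max D \<in> D\<close> by simp
  ultimately show ?thesis by (metis add_diff_inverse_nat atLeastLessThanSuc_atLeastAtMost le_SucI not_less)
qed simp

text \<open>Cut at the entry 1. An \<open>x\<close> before it and a smaller \<open>y\<close> after
  it would form the 312-occurrence \<open>x, 1, y\<close>; hence the values before 1 are the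
  smallest ones above 1, and together with 1 they form \<open>star A\<close>.\<close>

lemma av312_Suc_decompose:
  assumes "\<sigma> \<in> av312 (Suc n)"
  obtains A B where "\<sigma> = dsum (star A) B" "A \<in> av312 (length A)" "B \<in> av312 (n - length A)" "length A \<le> n"
proof -
  have \<sigma>: "distinct \<sigma>" "set \<sigma> = {1..Suc n}" "length \<sigma> = Suc n" "\<not> contains \<sigma> [3, 1, 2]"
    using assms permsD[of \<sigma>] by (simp_all add: av312_iff)
  have "1 \<in> set \<sigma>" using \<sigma>(2) by simp
  then obtain X Y where XY: "\<sigma> = X @ 1 # Y" by (meson split_list)
  have un: "set X \<union> set Y = {2..Suc n}" and disj: "set X \<inter> set Y = {}"
  proof -
    have "set X \<union> set Y = {1..Suc n} - {1}" using \<sigma>(1) unfolding \<sigma>(2)[symmetric] XY by auto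
    also have "\<dots> = {2..Suc n}" by auto
    finally show "set X \<union> set Y = {2..Suc n}" .
    show "set X \<inter> set Y = {}" using \<sigma>(1) unfolding XY by auto
  qed
  have len: "length X + length Y = n" using \<sigma>(3) XY by simp
  have less: "x < y" if xy: "x \<in> set X" "y \<in> set Y" for x y
  proof (rule ccontr)
    assume "\<not> x < y"
    moreover have "x \<noteq> y" using xy disj by blast
    moreover have "y \<in> {2..Suc n}" using xy(2) un by blast
    ultimately have "1 < y" "y < x" by auto
    moreover have "subseq ([x] @ [1] @ [y]) (X @ [1] @ Y)"
      using xy by (intro list_emb_append_mono) (simp_all add: subseq_singleton_left)
    hence "subseq [x, 1, y] \<sigma>" unfolding XY by simp
    ultimately show False using \<sigma>(4) unfolding contains_312_iff by blast
  qed
  have X: "set X = {2..<2 + length X}"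
  proof -
    have "set X = {2..<2 + card (set X)}"
    proof (rule down_closed_eq_atLeastAtMost)
      fix x y assume "x \<in> set X" "2 \<le> y" "y \<le> x"
      moreover from this have "x \<in> {2..Suc n}" unfolding un[symmetric] by blast
      with \<open>2 \<le> y\<close> \<open>y \<le> x\<close> have "y \<in> set X \<union> set Y" unfolding un by simp
      ultimately show "y \<in> set X" using less[of x y] by auto
    qed (use un in auto)
    thus ?thesis using \<sigma>(1) XY by (simp add: distinct_card)
  qed
  hence "set Y = {2..Suc n} - {2..<2 + length X}" using un disj by blast
  hence Y: "set Y = {2 + length X..Suc n}" by auto
  \<comment> \<open>\<open>X\<close> is lowered by one and \<open>Y\<close> by the length of
    \<open>star A\<close>. The truncated subtraction loses nothing, since the values are at least 2
    and at least \<open>2 + length X\<close>, respectively.\<close>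
  define A where "A = map (\<lambda>x. x - 1) X"
  define B where "B = map (\<lambda>x. x - Suc (length X)) Y"
  let ?t = "\<lambda>v. v + Suc (length X)"
  have mapA: "map Suc A = X" unfolding A_def map_map using X by (intro map_idI) auto
  have mapB: "map ?t B = Y" unfolding B_def map_map using Y by (intro map_idI) auto
  have lenA: "length A = length X" and lenB: "length B = length Y" by (simp_all add: A_def B_def)
  have eq: "\<sigma> = dsum (star A) B" using mapA mapB by (simp add: XY dsum_def star_eq lenA)
  have "distinct A" "distinct B"
    using \<sigma>(1) unfolding XY mapA[symmetric] mapB[symmetric] by (simp_all add: distinct_map)
  have "Suc ` set A = {2..<2 + length X}" using mapA X by (metis set_map)
  also have "\<dots> = Suc ` {1..length A}" unfolding image_Suc_atLeastAtMost lenA by auto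
  finally have "set A = {1..length A}" by (simp only: inj_image_eq_iff inj_Suc)
  with \<open>distinct A\<close> have A: "A \<in> perms" unfolding perms_iff ..
  have "?t ` set B = {2 + length X..Suc n}" using mapB Y by (metis set_map)
  also have "\<dots> = ?t ` {1..length B}" unfolding image_add_atLeastAtMost' lenB using len by auto
  finally have "set B = {1..length B}" by (subst (asm) inj_image_eq_iff) (simp_all add: inj_def)
  with \<open>distinct B\<close> have B: "B \<in> perms" unfolding perms_iff ..
  have "\<not> contains A [3, 1, 2]" "\<not> contains B [3, 1, 2]"
    using \<sigma>(4) unfolding eq by (simp_all add: A B star_perms contains_312_dsum contains_312_star)
  moreover have "length B = n - length A" "length A \<le> n" using len lenA lenB by linarith+
  ultimately show ?thesis using A B eq by (intro that) (simp_all add: av312_iff)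
qed

text \<open>\<open>map Suc A\<close> avoids the value 1 because \<open>A\<close> is a permutation,
  so the first 1 in the sum marks the end of \<open>star A\<close> and reveals both parts.\<close>

lemma dsum_star_inject:
  assumes "A \<in> perms" "A' \<in> perms" "dsum (star A) B = dsum (star A') B'"
  shows "A = A' \<and> B = B'"
proof -
  have "1 \<notin> set (map Suc A)" "1 \<notin> set (map Suc A')"
    using permsD(2)[OF assms(1)] permsD(2)[OF assms(2)] by auto
  moreover have "map Suc A @ 1 # map (\<lambda>v. v + length (star A)) B
      = map Suc A' @ 1 # map (\<lambda>v. v + length (star A')) B'"
    using assms(3) by (simp add: dsum_def star_eq)
  moreover have "takeWhile (\<lambda>x. x \<noteq> 1) (xs @ 1 # ys) = xs" if "1 \<notin> set xs" for xs ys :: "nat list"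
    using that by (induction xs) auto
  ultimately have *: "map Suc A = map Suc A'"
    "map (\<lambda>v. v + length (star A)) B = map (\<lambda>v. v + length (star A')) B'"
    by (metis, metis list.inject same_append_eq)
  from *(1) have "A = A'" by (simp add: inj_map_eq_map)
  with *(2) show ?thesis by (simp add: map_injective inj_def)
qed

section \<open>Inversion numbers of direct sums and stars\<close>

lemma inv_number_Nil [simp]: "inv_number [] = 0"
  by (simp add: inv_number_def)

text \<open>Splits the inversions by whether their left position is 0; those not involving position
  0 are shifted by one in both coordinates.\<close>

lemma inv_number_Cons: "inv_number (x # xs) = length (filter (\<lambda>y. y < x) xs) + inv_number xs"
proof -
  let ?I = "\<lambda>xs. {(i, j). i < j \<and> j < length xs \<and> xs ! i > (xs ! j :: nat)}"
  let ?J = "{j. j < length xs \<and> xs ! j < x}"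
  have fin: "finite (?I xs)" for xs
    by (rule finite_subset[of _ "{..<length xs} \<times> {..<length xs}"]) auto
  have "?I (x # xs) = (\<lambda>j. (0, Suc j)) ` ?J \<union> map_prod Suc Suc ` ?I xs"
  proof (rule set_eqI)
    fix ij :: "nat \<times> nat"
    obtain i j :: nat where ij: "ij = (i, j)" by fastforce
    show "ij \<in> ?I (x # xs) \<longleftrightarrow> ij \<in> (\<lambda>j. (0, Suc j)) ` ?J \<union> map_prod Suc Suc ` ?I xs"
      unfolding ij by (cases i; cases j) (auto simp: image_iff)
  qed
  hence "inv_number (x # xs) = card ((\<lambda>j. (0::nat, Suc j)) ` ?J \<union> map_prod Suc Suc ` ?I xs)"
    by (simp add: inv_number_def)
  also have "\<dots> = card ((\<lambda>j. (0::nat, Suc j)) ` ?J) + card (map_prod Suc Suc ` ?I xs)"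
    by (rule card_Un_disjoint) (use fin in auto)
  also have "card ((\<lambda>j. (0::nat, Suc j)) ` ?J) = card ?J"
    by (rule card_image) (auto simp: inj_on_def)
  also have "card (map_prod Suc Suc ` ?I xs) = card (?I xs)"
    by (rule card_image) (auto simp: inj_on_def)
  finally show ?thesis by (simp add: inv_number_def length_filter_conv_card)
qed

lemma inv_number_append:
  "inv_number (xs @ ys) =
     inv_number xs + inv_number ys + (\<Sum>x\<leftarrow>xs. length (filter (\<lambda>y. y < x) ys))"
  by (induction xs) (simp_all add: inv_number_Cons inv_number_Nil)

lemma inv_number_map: "strict_mono f \<Longrightarrow> inv_number (map f xs) = inv_number xs"
  unfolding inv_number_def by (rule arg_cong[where f = card]) (auto simp: strict_mono_less)

lemma inv_number_dsum:
  assumes "xs \<in> perms" "ys \<in> perms"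
  shows "inv_number (dsum xs ys) = inv_number xs + inv_number ys"
proof -
  have "filter (\<lambda>y. y < x) (map (\<lambda>v. v + length xs) ys) = []" if "x \<in> set xs" for x
    using dsum_less[OF assms that] by (fastforce simp: filter_empty_conv)
  hence "(\<Sum>x\<leftarrow>xs. length (filter (\<lambda>y. y < x) (map (\<lambda>v. v + length xs) ys))) = 0"
    by (simp only: list.size cong: map_cong) (simp add: sum_list_triv)
  thus ?thesis
    by (simp only: dsum_def inv_number_append inv_number_map[OF strict_mono_add_nat])
qed

text \<open>The final 1 forms an inversion with each entry before it.\<close>

lemma inv_number_star:
  assumes "A \<in> perms"
  shows "inv_number (star A) = inv_number A + length A"
proof -
  have "(\<Sum>x\<leftarrow>map Suc A. length (filter (\<lambda>y. y < x) [1])) = (\<Sum>x\<leftarrow>A. 1)"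
    unfolding map_map comp_def using permsD(2)[OF assms]
    by (intro arg_cong[where f = sum_list] map_cong) auto
  thus ?thesis
    by (simp add: star_eq inv_number_append inv_number_map strict_mono_Suc_nat inv_number_Cons sum_list_triv)
qed

section \<open>Generating functions and their recursion\<close>

definition weight :: "nat list \<Rightarrow> int poly" where
  "weight \<sigma> = monom 1 (inv_number \<sigma>)"

text \<open>Sums over \<open>A\<close> but tests avoidance on \<open>star A\<close>, the left part
  of the decomposition. This keeps the recursion uniform in the number of blocks;
  \<open>avoid_gf_cases\<close> translates back to \<open>F_inv\<close>.\<close>

definition avoid_gf :: "nat \<Rightarrow> nat list list \<Rightarrow> int poly" where
  "avoid_gf n ps = (\<Sum>A | A \<in> av312 n \<and> \<not> contains (star A) (star_sum ps). weight A)"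

text \<open>The empty pattern is always contained, which gives 0. For one block the stars cancel on
  both sides, and this is where the pair of 312 with a single block pattern enters. For more blocks
  only the star on \<open>A\<close> disappears.\<close>

lemma avoid_gf_cases:
  assumes "set ps \<subseteq> perms"
  shows "avoid_gf n ps =
    (case ps of [] \<Rightarrow> 0 | [p] \<Rightarrow> F_inv n {[3, 1, 2], p} | _ \<Rightarrow> F_inv n {[3, 1, 2], star_sum ps})"
proof -
  consider "ps = []" | p where "ps = [p]" | p p' ps' where "ps = p # p' # ps'"
    by (metis list.exhaust)
  thus ?thesis
  proof cases
    case 1
    thus ?thesis by (simp add: avoid_gf_def)
  next
    case (2 p)
    have "{A. A \<in> av312 n \<and> \<not> contains (star A) (star_sum ps)} = {A \<in> av312 n. \<not> contains A p}"
      using assms 2 contains_star_star by (auto simp: av312_iff)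
    thus ?thesis by (simp add: 2 avoid_gf_def F_inv_def avoiders_312_insert weight_def)
  next
    case (3 p p' ps')
    have "{A. A \<in> av312 n \<and> \<not> contains (star A) (star_sum ps)} = {A \<in> av312 n. \<not> contains A (star_sum ps)}"
      using assms 3 contains_star_star_sum by (auto simp: av312_iff simp del: star_sum_simps)
    thus ?thesis by (simp add: 3 avoid_gf_def F_inv_def avoiders_312_insert weight_def)
  qed
qed

text \<open>The \<open>A\<close> for which \<open>j\<close> is the largest number of initial blocks that fit into \<open>A\<^sub>*\<close>.\<close>

definition level_set :: "nat \<Rightarrow> nat list list \<Rightarrow> nat \<Rightarrow> nat list set" where
  "level_set m ps j = {A \<in> av312 m. contains (star A) (star_sum (take j ps)) \<and>
     \<not> contains (star A) (star_sum (take (Suc j) ps))}"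

lemma finite_level_set [simp]: "finite (level_set m ps j)"
  by (simp add: level_set_def)

lemma level_set_unique:
  assumes "A \<in> level_set m ps i" "A \<in> level_set m' ps j"
  shows "i = j"
proof (rule ccontr)
  assume "i \<noteq> j"
  then consider "Suc i \<le> j" | "Suc j \<le> i" by linarith
  thus False using assms contains_star_sum_take_mono unfolding level_set_def by cases blast+
qed

lemma level_set_exists:
  assumes "A \<in> av312 m" "\<not> contains (star A) (star_sum ps)"
  obtains j where "j < length ps" "A \<in> level_set m ps j"
proof -
  let ?P = "\<lambda>j. \<not> contains (star A) (star_sum (take j ps))"
  have P: "?P (length ps)" "\<not> ?P 0" using assms(2) by simp_all
  \<comment> \<open>\<open>Suc j\<close> is the least number of initial blocks that do not fit; it
    is positive because the empty prefix always fits.\<close>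
  obtain j where "j < length ps" "\<not> ?P j" "?P (Suc j)"
    using ex_least_nat_less[of ?P "length ps"] P by blast
  with assms(1) that show ?thesis by (auto simp: level_set_def)
qed

text \<open>The avoiders of a shorter prefix also avoid the longer one, so the level set is a
  difference of nested sets.\<close>

lemma sum_level_set:
  "(\<Sum>A\<in>level_set m ps j. weight A) = avoid_gf m (take (Suc j) ps) - avoid_gf m (take j ps)"
proof -
  let ?N = "\<lambda>j. {A. A \<in> av312 m \<and> \<not> contains (star A) (star_sum (take j ps))}"
  have "level_set m ps j = ?N (Suc j) - ?N j" by (auto simp: level_set_def)
  moreover have "?N j \<subseteq> ?N (Suc j)" using contains_star_sum_take_mono[of _ "Suc j" ps j] by auto
  ultimately show ?thesis unfolding avoid_gf_def by (simp add: sum_diff)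
qed

text \<open>The prefixes that fit into \<open>star A\<close> are those with at most \<open>j\<close>
  blocks. Among these cuts, the one at \<open>j\<close> leaves the shortest suffix for
  \<open>B\<close>, so it succeeds whenever any of them does.\<close>

lemma contains_dsum_level_set:
  assumes "A \<in> level_set m ps j" "B \<in> perms" "set ps \<subseteq> perms" "j < length ps"
  shows "contains (dsum (star A) B) (star_sum ps) \<longleftrightarrow> contains B (star_sum (drop j ps))"
proof -
  have A: "star A \<in> perms" "contains (star A) (star_sum (take j ps))"
    using assms(1) by (auto simp: level_set_def av312_iff star_perms)
  have "i \<le> j" if "contains (star A) (star_sum (take i ps))" for i
    using that assms(1) contains_star_sum_take_mono[of "star A" i ps "Suc j"]
    unfolding level_set_def mem_Collect_eq by (metis not_less_eq_eq)
  thus ?thesis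
    unfolding contains_dsum_star_sum[OF A(1) assms(2,3)]
    using A(2) assms(4) contains_star_sum_drop_mono by (metis less_imp_le)
qed

text \<open>Sorts the avoiders \<open>dsum (star A) B\<close> by \<open>m = length A\<close> and by
  the level \<open>j\<close> of \<open>A\<close>. The factor \<open>monom 1 m\<close> records the
  inversions with the 1 that ends \<open>star A\<close>.\<close>

lemma F_inv_Suc:
  assumes "set ps \<subseteq> perms"
  shows "F_inv (Suc n) {[3, 1, 2], star_sum ps} =
    (\<Sum>m\<le>n. \<Sum>j<length ps. monom 1 m *
       (avoid_gf m (take (Suc j) ps) - avoid_gf m (take j ps)) *
       F_inv (n - m) {[3, 1, 2], star_sum (drop j ps)})"
proof -
  let ?Av = "\<lambda>k \<pi>. avoiders k {[3, 1, 2], \<pi>}"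
  let ?X = "\<lambda>m j. level_set m ps j \<times> ?Av (n - m) (star_sum (drop j ps))"
  let ?S = "SIGMA m:{..n}. SIGMA j:{..<length ps}. ?X m j"
  \<comment> \<open>The map forgets \<open>m\<close> and \<open>j\<close>, yet stays injective:
    \<open>m\<close> is the length of \<open>A\<close>, and \<open>level_set_unique\<close> recovers
    \<open>j\<close>.\<close>
  let ?g = "\<lambda>(m :: nat, j :: nat, A, B). dsum (star A) B"
  have A: "A \<in> perms" "length A = m" if "A \<in> level_set m ps j" for A m j
    using that by (auto simp: level_set_def av312_iff)
  have B: "B \<in> perms" if "B \<in> ?Av k \<pi>" for B k \<pi>
    using that by (auto simp: avoiders_312_insert av312_iff)
  have bij: "bij_betw ?g ?S (?Av (Suc n) (star_sum ps))"
  proof (rule bij_betw_imageI)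
    show "inj_on ?g ?S"
    proof (rule inj_onI)
      fix x y assume "x \<in> ?S" "y \<in> ?S" "?g x = ?g y"
      then obtain m j A B m' j' A' B' where *: "x = (m, j, A, B)" "y = (m', j', A', B')"
        "A \<in> level_set m ps j" "A' \<in> level_set m' ps j'" "dsum (star A) B = dsum (star A') B'"
        by auto
      have "A = A' \<and> B = B'" using dsum_star_inject A(1) *(3-5) by blast
      with * show "x = y" using level_set_unique A(2) by blast
    qed
    show "?g ` ?S = ?Av (Suc n) (star_sum ps)"
    proof (intro set_eqI iffI)
      fix \<sigma> assume "\<sigma> \<in> ?g ` ?S"
      then obtain m j A B where *: "m \<le> n" "j < length ps" "A \<in> level_set m ps j"
        "B \<in> ?Av (n - m) (star_sum (drop j ps))" "\<sigma> = dsum (star A) B" by auto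
      have "A \<in> av312 m" "B \<in> av312 (n - m)"
        using *(3,4) by (simp_all add: level_set_def avoiders_312_insert)
      from dsum_star_in_av312[OF this] have "\<sigma> \<in> av312 (Suc (m + (n - m)))"
        unfolding *(5) .
      moreover have "\<not> contains \<sigma> (star_sum ps)"
        using contains_dsum_level_set[OF *(3) B[OF *(4)] assms *(2)] *(4,5)
        by (simp add: avoiders_312_insert)
      ultimately show "\<sigma> \<in> ?Av (Suc n) (star_sum ps)" using *(1) by (simp add: avoiders_312_insert)
    next
      fix \<sigma> assume "\<sigma> \<in> ?Av (Suc n) (star_sum ps)"
      hence \<sigma>: "\<sigma> \<in> av312 (Suc n)" "\<not> contains \<sigma> (star_sum ps)" by (auto simp: avoiders_312_insert)
      from \<sigma>(1) obtain A B where AB: "\<sigma> = dsum (star A) B" "A \<in> av312 (length A)"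
        "B \<in> av312 (n - length A)" "length A \<le> n" by (rule av312_Suc_decompose)
      \<comment> \<open>\<open>star A\<close> is a prefix of \<open>\<sigma>\<close>, so it avoids
        the whole pattern and \<open>A\<close> has a level below \<open>length ps\<close>.\<close>
      have "\<not> contains (star A) (star_sum ps)"
        using \<sigma>(2) contains_subseq[of "star A" _ \<sigma>] by (auto simp: AB(1) dsum_def)
      with AB(2) obtain j where j: "j < length ps" "A \<in> level_set (length A) ps j"
        by (rule level_set_exists)
      have "\<not> contains B (star_sum (drop j ps))"
        using contains_dsum_level_set[OF j(2) _ assms j(1), of B] AB \<sigma>(2) by (simp add: av312_iff)
      with AB j have "(length A, j, A, B) \<in> ?S" by (auto simp: avoiders_312_insert)
      thus "\<sigma> \<in> ?g ` ?S" unfolding AB(1) by force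
    qed
  qed
  have block: "(\<Sum>(A, B)\<in>?X m j. weight (dsum (star A) B)) = monom 1 m *
       (avoid_gf m (take (Suc j) ps) - avoid_gf m (take j ps)) *
       F_inv (n - m) {[3, 1, 2], star_sum (drop j ps)}" for m j
  proof -
    have "weight (dsum (star A) B) = monom 1 m * weight A * weight B" if "(A, B) \<in> ?X m j" for A B
      using that A[of A m j] B[of B] star_perms[of A]
      by (auto simp: weight_def inv_number_dsum inv_number_star mult_monom add_ac)
    hence "(\<Sum>(A, B)\<in>?X m j. weight (dsum (star A) B)) = (\<Sum>(A, B)\<in>?X m j. monom 1 m * weight A * weight B)"
      by (intro sum.cong) auto
    also have "\<dots> = (\<Sum>A\<in>level_set m ps j. monom 1 m * weight A) *
        F_inv (n - m) {[3, 1, 2], star_sum (drop j ps)}"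
      unfolding F_inv_def weight_def[symmetric] sum_product by (rule sum.cartesian_product[symmetric])
    finally show ?thesis unfolding sum_distrib_left[symmetric] sum_level_set .
  qed
  from bij have "F_inv (Suc n) {[3, 1, 2], star_sum ps} = (\<Sum>x\<in>?S. weight (?g x))"
    unfolding F_inv_def weight_def[symmetric] by (rule sum.reindex_bij_betw[symmetric])
  also have "\<dots> = (\<Sum>m\<le>n. \<Sum>j<length ps. \<Sum>(A, B)\<in>?X m j. weight (dsum (star A) B))"
    by (subst sum.Sigma[symmetric], simp, simp)+ (simp add: case_prod_unfold sum.Sigma)
  finally show ?thesis unfolding block .
qed

section \<open>Induction on the length\<close>

text \<open>Strong induction on \<open>n\<close> for all block lists at once, because the recursion
  passes to prefixes and suffixes of the lists.\<close>

lemma F_inv_star_sum_eq: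
  assumes "list_all2 (\<lambda>p p'. p \<in> perms \<and> p' \<in> perms \<and>
    inv_Wilf_equiv {[3, 1, 2], p} {[3, 1, 2], p'}) ps ps'" (is "list_all2 ?R _ _")
  shows "F_inv n {[3, 1, 2], star_sum ps} = F_inv n {[3, 1, 2], star_sum ps'}"
  using assms
proof (induction n arbitrary: ps ps' rule: less_induct)
  case (less n)
  have perms: "set qs \<subseteq> perms" "set qs' \<subseteq> perms" if "list_all2 ?R qs qs'" for qs qs'
    using that by (auto simp: list_all2_conv_all_nth in_set_conv_nth)
  show ?case
  proof (cases n)
    case 0
    \<comment> \<open>The only candidate is \<open>[]\<close>, which contains the pattern exactly
      when there are no blocks.\<close>
    have "avoiders 0 {[3, 1, 2], star_sum qs} = (if qs = [] then {} else {[]})" for qs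
    proof (cases qs)
      case (Cons q qs')
      hence "star_sum qs \<noteq> []" by (simp add: dsum_def star_eq)
      with Cons show ?thesis by (auto simp: avoiders_def perms_of_iff contains_Nil_left)
    qed (auto simp: avoiders_def)
    moreover have "ps = [] \<longleftrightarrow> ps' = []" using less.prems by auto
    ultimately show ?thesis by (simp add: F_inv_def 0)
  next
    case (Suc k)
    \<comment> \<open>A one-block list is settled by the assumed equivalence, which holds at every
      length; two or more blocks use the induction hypothesis at \<open>m < n\<close>.\<close>
    have gf: "avoid_gf m qs = avoid_gf m qs'" if "m \<le> k" and R: "list_all2 ?R qs qs'" for m qs qs'
    proof -
      have "F_inv m {[3, 1, 2], star_sum qs} = F_inv m {[3, 1, 2], star_sum qs'}"
        using less.IH[OF _ R] that(1) Suc by simp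
      with R show ?thesis
        unfolding avoid_gf_cases[OF perms(1)[OF R]] avoid_gf_cases[OF perms(2)[OF R]]
        by (auto split: list.splits simp: inv_Wilf_equiv_def)
    qed
    have "avoid_gf m (take i ps) = avoid_gf m (take i ps')" if "m \<le> k" for m i
      using that less.prems by (intro gf list_all2_takeI)
    \<comment> \<open>For \<open>j = 0\<close> the suffix is the whole list, but the length
      \<open>k - m\<close> is still below \<open>n\<close>.\<close>
    moreover have "F_inv (k - m) {[3, 1, 2], star_sum (drop j ps)}
        = F_inv (k - m) {[3, 1, 2], star_sum (drop j ps')}" for m j
      using less.prems Suc by (intro less.IH list_all2_dropI) simp_all
    ultimately show ?thesis
      unfolding Suc F_inv_Suc[OF perms(1)[OF less.prems]] F_inv_Suc[OF perms(2)[OF less.prems]]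
        list_all2_lengthD[OF less.prems] by (intro sum.cong) simp_all
  qed
qed

theorem proposition1p2:
  fixes r :: nat and p p' :: "nat \<Rightarrow> nat list" and \<pi> \<pi>' :: "nat list"
  assumes "\<And>i. i \<in> {1..r} \<Longrightarrow> p i \<in> perms"
    and "\<And>i. i \<in> {1..r} \<Longrightarrow> p' i \<in> perms"
    and "\<And>i. i \<in> {1..r} \<Longrightarrow> inv_Wilf_equiv {[3, 1, 2], p i} {[3, 1, 2], p' i}"
    and "\<pi> = inflation (iota r) (map (\<lambda>i. star (p i)) [1..<Suc r])"
    and "\<pi>' = inflation (iota r) (map (\<lambda>i. star (p' i)) [1..<Suc r])"
  shows "inv_Wilf_equiv {[3, 1, 2], \<pi>} {[3, 1, 2], \<pi>'}"
  unfolding inv_Wilf_equiv_def assms(4,5) inflation_iota_star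
proof
  fix n
  show "F_inv n {[3, 1, 2], star_sum (map p [1..<Suc r])} =
      F_inv n {[3, 1, 2], star_sum (map p' [1..<Suc r])}"
    using assms(1-3) by (intro F_inv_star_sum_eq) (simp add: list_all2_conv_all_nth del: upt_Suc)
qed

end
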